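(* Let $m,k,a\ge 1$ be integers such that $m$ is a multiple of $k$, and let $K^{(m)}_a$ be the complete $m$-partite graph with $a$ vertices in each partite set. Then $K^{(m)}_a$ can be $k$-colored with defect $(m/k-1)a$, and this is best possible; that is, \[ D(K^{(m)}_a,k)=\left(\frac{m}{k}-1\right)a . \]
   Context: Graphs are finite and simple. For a graph $G$ and a positive integer $k$, a (fractional) $k$-coloring of $G$ is an assignment to every vertex $v$ of real numbers $f_1(v),\dots,f_k(v)\ge 0$ with $\sum_{j=1}^k f_j(v)=1$ ($f_j(v)$ is the usage of color $j$ at $v$). The defect of $v$ is $\mathrm{df}(v)=\sum_{w\in N(v)}\sum_{j=1}^k\min(f_j(v),f_j(w))$, where $N(v)$ is the set of neighbors of $v$. The defect of the coloring is $\max_v \mathrm{df}(v)$, and the minimum defect $D(G,k)$ is the minimum of this quantity over all $k$-colorings of $G$. *)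

theory Defs
  imports
    "HOL-Analysis.Analysis"
    "HOL-Library.Disjoint_Sets"
    "Graph_Theory.Pair_Digraph"
begin

text \<open>
  A finite simple graph is a \<open>pair_graph\<close>: a finite, loop-free digraph without parallel arcs whose
  arc relation is symmetric. An edge is represented by its two opposite arcs.
\<close>

definition neighbors :: "'a pair_pre_digraph \<Rightarrow> 'a \<Rightarrow> 'a set" where
  "neighbors G v = {w. (v, w) \<in> parcs G}"

definition frac_coloring :: "'a pair_pre_digraph \<Rightarrow> nat \<Rightarrow> ('a \<Rightarrow> nat \<Rightarrow> real) \<Rightarrow> bool" where
  "frac_coloring G k f \<longleftrightarrow>
     (\<forall>v\<in>pverts G. (\<forall>j\<in>{1..k}. 0 \<le> f v j) \<and> (\<Sum>j=1..k. f v j) = 1)"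

definition vertex_defect :: "'a pair_pre_digraph \<Rightarrow> nat \<Rightarrow> ('a \<Rightarrow> nat \<Rightarrow> real) \<Rightarrow> 'a \<Rightarrow> real" where
  "vertex_defect G k f v = (\<Sum>w\<in>neighbors G v. \<Sum>j=1..k. min (f v j) (f w j))"

text \<open>The maximum is meaningful only for a graph with at least one vertex.\<close>

definition coloring_defect :: "'a pair_pre_digraph \<Rightarrow> nat \<Rightarrow> ('a \<Rightarrow> nat \<Rightarrow> real) \<Rightarrow> real" where
  "coloring_defect G k f = Max (vertex_defect G k f ` pverts G)"

text \<open>
  \<open>LEAST\<close> denotes a genuine (attained) minimum; its value is unspecified when no minimum exists.
\<close>

definition min_defect :: "'a pair_pre_digraph \<Rightarrow> nat \<Rightarrow> real" where
  "min_defect G k = (LEAST d. \<exists>f. frac_coloring G k f \<and> d = coloring_defect G k f)"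

text \<open>
  As with the complete bipartite graphs of \<open>Graph_Theory\<close>, this is a predicate, so it covers every
  isomorphic copy: \<open>G\<close> is complete multipartite with \<open>m\<close> partite sets, each of size \<open>a\<close>. The
  sets in a \<open>partition_on\<close> are nonempty, so the reading is the intended one for \<open>a \<ge> 1\<close>.
\<close>

definition complete_multipartite :: "nat \<Rightarrow> nat \<Rightarrow> 'a pair_pre_digraph \<Rightarrow> bool" where
  "complete_multipartite m a G \<longleftrightarrow> pair_graph G \<and>
     (\<exists>Ps. partition_on (pverts G) Ps \<and> card Ps = m \<and> (\<forall>P\<in>Ps. card P = a) \<and>
       parcs G = {(u, v). u \<in> pverts G \<and> v \<in> pverts G \<and> \<not> (\<exists>P\<in>Ps. u \<in> P \<and> v \<in> P)})"

lemma complete_multipartite_exists: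
  assumes "a \<ge> 1"
  shows "complete_multipartite m a
    \<lparr>pverts = {..<m} \<times> {..<a}, parcs = {(u, v). u \<in> {..<m} \<times> {..<a} \<and> v \<in> {..<m} \<times> {..<a} \<and> fst u \<noteq> fst v}\<rparr>"
    (is "complete_multipartite m a ?G")
proof -
  let ?Ps = "(\<lambda>i. {i} \<times> {..<a}) ` {..<m}"
  have "finite (parcs ?G)"
    by (rule finite_subset[of _ "({..<m} \<times> {..<a}) \<times> ({..<m} \<times> {..<a})"]) auto
  then have "pair_graph ?G"
    by unfold_locales (auto simp: symmetric_def arcs_ends_def arc_to_ends_def intro!: symI)
  moreover have "\<forall>i. {i} \<times> {..<a} \<noteq> {}"
    using assms by (auto simp: Sigma_empty_iff lessThan_empty_iff)
  then have "partition_on (pverts ?G) ?Ps"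
    by (fastforce simp: partition_on_def disjoint_def)
  moreover have "inj_on (\<lambda>i. {i} \<times> {..<a}) {..<m}"
    using assms by (auto simp: inj_on_def times_eq_iff lessThan_empty_iff)
  then have "card ?Ps = m"
    by (simp add: card_image)
  moreover have "\<forall>P\<in>?Ps. card P = a"
    by (auto simp: card_cartesian_product)
  moreover have "parcs ?G = {(u, v). u \<in> pverts ?G \<and> v \<in> pverts ?G \<and> \<not> (\<exists>P\<in>?Ps. u \<in> P \<and> v \<in> P)}"
    by auto
  ultimately show ?thesis
    unfolding complete_multipartite_def by blast
qed

end

theory Submission
  imports Defs
begin

text \<open>
  Write \<open>ov v w = (\<Sum>j. min (f v j) (f w j))\<close> for the overlap of two vertices, so that the defect of
  a vertex is its total overlap with its neighbors.

  Lower bound: all usages lie in \<open>[0, 1]\<close>, so \<open>min x y \<ge> x * y\<close>. Hence the overlaps of all ordered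
  pairs of vertices, including the pairs \<open>(v, v)\<close>, sum to at least \<open>\<Sum>j. S\<^sub>j\<^sup>2\<close>, where \<open>S\<^sub>j\<close> is the
  total usage of color \<open>j\<close>. The \<open>S\<^sub>j\<close> add up to the number \<open>n\<close> of vertices, so Cauchy-Schwarz
  gives at least \<open>n\<^sup>2 / k\<close>. An overlap is at most \<open>1\<close>; if every vertex has at most \<open>b\<close>
  non-neighbors (itself included), the non-adjacent pairs therefore account for at most \<open>n * b\<close>
  of this total. The defects thus sum to at least \<open>n\<^sup>2 / k - n * b\<close>, and some vertex has defect at
  least \<open>n / k - b\<close> (lemma \<open>coloring_defect_lower_bound\<close>). For \<open>m\<close> parts of size \<open>a\<close> we have
  \<open>n = m * a\<close> and \<open>b = a\<close>.

  Upper bound: give each part a single color, using every color on exactly \<open>m / k\<close> parts. The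
  defect of a vertex is then the number of vertices of its color outside its own part
  (lemma \<open>vertex_defect_pure_coloring\<close>).
\<close>

section \<open>Lower bound from the number of non-neighbors\<close>

lemma frac_coloring_le_1:
  assumes "frac_coloring G k f" "v \<in> pverts G" "j \<in> {1..k}"
  shows "f v j \<le> 1"
proof -
  have "f v j \<le> (\<Sum>j=1..k. f v j)"
    using assms by (intro member_le_sum) (auto simp: frac_coloring_def)
  then show ?thesis
    using assms by (simp add: frac_coloring_def)
qed

lemma overlap_le_1:
  assumes "frac_coloring G k f" "v \<in> pverts G"
  shows "(\<Sum>j=1..k. min (f v j) (f w j)) \<le> 1"
proof -
  have "(\<Sum>j=1..k. min (f v j) (f w j)) \<le> (\<Sum>j=1..k. f v j)"
    by (intro sum_mono) simp
  then show ?thesis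
    using assms by (simp add: frac_coloring_def)
qed

text \<open>
  Replacing \<open>min\<close> by the smaller product makes the double sum over the vertices factor into a
  square for each color.
\<close>

lemma sum_overlap_ge:
  assumes col: "frac_coloring G k f" and "k \<ge> 1"
  shows "(real (card (pverts G)))\<^sup>2 / real k
    \<le> (\<Sum>v\<in>pverts G. \<Sum>w\<in>pverts G. \<Sum>j=1..k. min (f v j) (f w j))"
proof -
  let ?V = "pverts G"
  define S where "S j = (\<Sum>v\<in>?V. f v j)" for j
  have "(\<Sum>j=1..k. S j) = (\<Sum>v\<in>?V. \<Sum>j=1..k. f v j)"
    unfolding S_def by (rule sum.swap)
  also have "\<dots> = real (card ?V)"
    using col by (simp add: frac_coloring_def)
  finally have "(real (card ?V))\<^sup>2 = (\<Sum>j=1..k. S j)\<^sup>2"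
    by simp
  also have "\<dots> \<le> real k * (\<Sum>j=1..k. (S j)\<^sup>2)"
    using Cauchy_Schwarz_ineq_sum[of "\<lambda>_. 1" S "{1..k}"] by simp
  finally have "(real (card ?V))\<^sup>2 / real k \<le> (\<Sum>j=1..k. (S j)\<^sup>2)"
    using \<open>k \<ge> 1\<close> by (simp add: divide_le_eq mult.commute)
  also have "\<dots> = (\<Sum>j=1..k. \<Sum>v\<in>?V. \<Sum>w\<in>?V. f v j * f w j)"
    by (simp add: S_def power2_eq_square sum_product)
  also have "\<dots> = (\<Sum>v\<in>?V. \<Sum>j=1..k. \<Sum>w\<in>?V. f v j * f w j)"
    by (rule sum.swap)
  also have "\<dots> = (\<Sum>v\<in>?V. \<Sum>w\<in>?V. \<Sum>j=1..k. f v j * f w j)"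
    by (intro sum.cong refl sum.swap)
  also have "\<dots> \<le> (\<Sum>v\<in>?V. \<Sum>w\<in>?V. \<Sum>j=1..k. min (f v j) (f w j))"
  proof (intro sum_mono)
    fix v w j assume vwj: "v \<in> ?V" "w \<in> ?V" "j \<in> {1..k}"
    have "0 \<le> f v j" "0 \<le> f w j"
      using col vwj by (auto simp: frac_coloring_def)
    moreover have "f v j \<le> 1" "f w j \<le> 1"
      using frac_coloring_le_1[OF col] vwj by auto
    ultimately show "f v j * f w j \<le> min (f v j) (f w j)"
      by (simp add: mult_left_le mult_left_le_one_le)
  qed
  finally show ?thesis .
qed

text \<open>The maximum defect is at least the average one.\<close>

lemma coloring_defect_lower_bound:
  assumes col: "frac_coloring G k f" and "k \<ge> 1"
    and fin: "finite (pverts G)" and ne: "pverts G \<noteq> {}"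
    and nb: "\<And>v. v \<in> pverts G \<Longrightarrow> neighbors G v \<subseteq> pverts G"
    and non: "\<And>v. v \<in> pverts G \<Longrightarrow> card (pverts G - neighbors G v) \<le> b"
  shows "real (card (pverts G)) / real k - real b \<le> coloring_defect G k f"
proof -
  let ?V = "pverts G" and ?n = "real (card (pverts G))"
  let ?ov = "\<lambda>v w. \<Sum>j=1..k. min (f v j) (f w j)"
  have npos: "?n > 0"
    using fin ne by (simp add: card_gt_0_iff)
  have row: "(\<Sum>w\<in>?V. ?ov v w) \<le> coloring_defect G k f + real b" if v: "v \<in> ?V" for v
  proof -
    have "(\<Sum>w\<in>?V - neighbors G v. ?ov v w) \<le> real (card (?V - neighbors G v)) * 1"
      by (rule sum_bounded_above) (rule overlap_le_1[OF col v])
    also have "\<dots> \<le> real b"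
      using non[OF v] by simp
    finally have "(\<Sum>w\<in>?V - neighbors G v. ?ov v w) \<le> real b" .
    moreover have "vertex_defect G k f v \<le> coloring_defect G k f"
      unfolding coloring_defect_def using fin v by simp
    moreover have "(\<Sum>w\<in>?V. ?ov v w)
        = (\<Sum>w\<in>?V - neighbors G v. ?ov v w) + vertex_defect G k f v"
      unfolding vertex_defect_def by (rule sum.subset_diff[OF nb[OF v] fin])
    ultimately show ?thesis
      by linarith
  qed
  have "?n * (?n / real k) \<le> (\<Sum>v\<in>?V. \<Sum>w\<in>?V. ?ov v w)"
    using sum_overlap_ge[OF col \<open>k \<ge> 1\<close>] by (simp add: power2_eq_square)
  also have "\<dots> \<le> ?n * (coloring_defect G k f + real b)"
    by (rule sum_bounded_above) (rule row)
  finally have "?n / real k \<le> coloring_defect G k f + real b"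
    using npos by (simp only: mult_le_cancel_left_pos)
  then show ?thesis
    by simp
qed

section \<open>Colorings with one color per vertex\<close>

definition pure_coloring :: "('a \<Rightarrow> nat) \<Rightarrow> 'a \<Rightarrow> nat \<Rightarrow> real" where
  "pure_coloring c v j = (if j = c v then 1 else 0)"

lemma frac_coloring_pure_coloring:
  assumes "\<And>v. v \<in> pverts G \<Longrightarrow> c v \<in> {1..k}"
  shows "frac_coloring G k (pure_coloring c)"
  using assms by (auto simp: frac_coloring_def pure_coloring_def)

lemma vertex_defect_pure_coloring:
  assumes "c v \<in> {1..k}" and "finite (neighbors G v)"
  shows "vertex_defect G k (pure_coloring c) v = real (card {w \<in> neighbors G v. c w = c v})"
proof -
  have "(\<Sum>j=1..k. min (pure_coloring c v j) (pure_coloring c w j)) = (if c w = c v then 1 else 0)"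
    for w
  proof -
    have "(\<Sum>j=1..k. min (pure_coloring c v j) (pure_coloring c w j))
        = (\<Sum>j=1..k. if j = c v then (if c w = c v then 1 else 0) else 0)"
      by (intro sum.cong) (auto simp: pure_coloring_def)
    then show ?thesis
      using assms(1) by simp
  qed
  then show ?thesis
    unfolding vertex_defect_def using assms(2) by (simp add: sum.If_cases Int_def)
qed

lemma card_residue_class_below:
  fixes m k r :: nat
  assumes "k dvd m" "r < k"
  shows "card {i. i < m \<and> i mod k = r} = m div k"
proof -
  obtain q where m: "m = k * q"
    using assms(1) by (elim dvdE)
  have "{i. i < m \<and> i mod k = r} = (\<lambda>t. k * t + r) ` {..<q}"
  proof (intro equalityI subsetI)
    fix i assume i: "i \<in> {i. i < m \<and> i mod k = r}"
    have "i = k * (i div k) + r"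
      using i mult_div_mod_eq[of k i] by simp
    moreover have "i div k < q"
      using i by (simp add: m less_mult_imp_div_less mult.commute)
    ultimately show "i \<in> (\<lambda>t. k * t + r) ` {..<q}"
      by blast
  next
    fix i assume "i \<in> (\<lambda>t. k * t + r) ` {..<q}"
    then obtain t where t: "t < q" "i = k * t + r"
      by auto
    have "i < k * Suc t"
      using t assms(2) by simp
    also have "\<dots> \<le> m"
      unfolding m using t by (intro mult_le_mono) auto
    finally show "i \<in> {i. i < m \<and> i mod k = r}"
      using t assms(2) by simp
  qed
  moreover have "inj_on (\<lambda>t. k * t + r) {..<q}"
    using assms(2) by (auto simp: inj_on_def)
  ultimately show ?thesis
    using assms(2) by (simp add: card_image m)
qed

section \<open>Complete multipartite graphs\<close>

text \<open>
  The part of a vertex is recovered from the graph as its set of non-neighbors, which is the form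
  in which both bounds use the partition.
\<close>

lemma complete_multipartite_parts:
  assumes "complete_multipartite m a G"
  obtains Ps where
    "finite (pverts G)" "partition_on (pverts G) Ps" "card Ps = m" "\<forall>P\<in>Ps. card P = a"
    "\<forall>v\<in>pverts G. neighbors G v \<subseteq> pverts G"
    "\<forall>P\<in>Ps. \<forall>v\<in>P. pverts G - neighbors G v = P"
    "card (pverts G) = m * a"
proof -
  from assms obtain Ps where G: "pair_graph G" and part: "partition_on (pverts G) Ps"
    and m: "card Ps = m" and a: "\<forall>P\<in>Ps. card P = a"
    and arcs: "parcs G = {(u, v). u \<in> pverts G \<and> v \<in> pverts G \<and> \<not> (\<exists>P\<in>Ps. u \<in> P \<and> v \<in> P)}"
    unfolding complete_multipartite_def by blast
  interpret pair_graph G by (rule G)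
  have fin: "finite (pverts G)" by simp
  have U: "\<Union>Ps = pverts G" and disj: "\<And>P P'. P \<in> Ps \<Longrightarrow> P' \<in> Ps \<Longrightarrow> P \<noteq> P' \<Longrightarrow> P \<inter> P' = {}"
    using part by (auto simp: partition_on_def disjoint_def)
  have nb: "\<forall>v\<in>pverts G. neighbors G v \<subseteq> pverts G"
    using arcs by (auto simp: neighbors_def)
  have non: "\<forall>P\<in>Ps. \<forall>v\<in>P. pverts G - neighbors G v = P"
  proof (intro ballI)
    fix P v assume P: "P \<in> Ps" "v \<in> P"
    then have "w \<in> P \<longleftrightarrow> (\<exists>P\<in>Ps. v \<in> P \<and> w \<in> P)" for w
      using disj by blast
    then show "pverts G - neighbors G v = P"
      using P U arcs by (auto simp: neighbors_def)
  qed
  have "a * card Ps = card (\<Union>Ps)"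
    using finite_elements[OF fin part] fin U a disj by (intro card_partition) auto
  then have n: "card (pverts G) = m * a"
    using m U by (simp add: mult.commute)
  from that[OF fin part m a nb non n] show thesis .
qed

theorem complete_multipartite_defect_lower_bound:
  assumes "m \<ge> 1" "k \<ge> 1" "a \<ge> 1" "complete_multipartite m a G" "frac_coloring G k f"
  shows "(real m / real k - 1) * real a \<le> coloring_defect G k f"
proof -
  obtain Ps where fin: "finite (pverts G)"
    and part: "partition_on (pverts G) Ps" and a: "\<forall>P\<in>Ps. card P = a"
    and nb: "\<forall>v\<in>pverts G. neighbors G v \<subseteq> pverts G"
    and non: "\<forall>P\<in>Ps. \<forall>v\<in>P. pverts G - neighbors G v = P"
    and n: "card (pverts G) = m * a"
    by (rule complete_multipartite_parts[OF assms(4)])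
  have "pverts G \<noteq> {}"
    using n assms(1,3) by force
  moreover have "card (pverts G - neighbors G v) \<le> a" if v: "v \<in> pverts G" for v
  proof -
    obtain P where "P \<in> Ps" "v \<in> P"
      using v part by (auto simp: partition_on_def)
    then show ?thesis
      using non a by simp
  qed
  ultimately have "real (card (pverts G)) / real k - real a \<le> coloring_defect G k f"
    using assms fin nb by (intro coloring_defect_lower_bound) auto
  then show ?thesis
    by (simp add: n algebra_simps)
qed

text \<open>
  Coloring the part numbered \<open>i\<close> with \<open>i mod k\<close> uses each color equally often; every vertex then
  has the same defect.
\<close>

theorem complete_multipartite_coloring_exists:
  fixes G :: "'a pair_pre_digraph"
  assumes "m \<ge> 1" "k \<ge> 1" "a \<ge> 1" "k dvd m" "complete_multipartite m a G"
  shows "\<exists>f. frac_coloring G k f \<and> coloring_defect G k f = (real m / real k - 1) * real a"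
proof -
  obtain Ps where fin: "finite (pverts G)"
    and part: "partition_on (pverts G) Ps" and m: "card Ps = m" and a: "\<forall>P\<in>Ps. card P = a"
    and nb: "\<forall>v\<in>pverts G. neighbors G v \<subseteq> pverts G"
    and non: "\<forall>P\<in>Ps. \<forall>v\<in>P. pverts G - neighbors G v = P"
    and n: "card (pverts G) = m * a"
    by (rule complete_multipartite_parts[OF assms(5)])
  have U: "\<Union>Ps = pverts G" and disj: "\<And>P P'. P \<in> Ps \<Longrightarrow> P' \<in> Ps \<Longrightarrow> P \<noteq> P' \<Longrightarrow> P \<inter> P' = {}"
    using part by (auto simp: partition_on_def disjoint_def)
  define Q where "Q v = pverts G - neighbors G v" for v
  have Q_eq: "Q v = P" if "P \<in> Ps" "v \<in> P" for v P
    using non that by (simp add: Q_def)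
  have Q: "Q v \<in> Ps \<and> v \<in> Q v" if "v \<in> pverts G" for v
    using that U Q_eq by (metis UnionE)
  obtain h where h: "bij_betw h Ps {..<m}"
    using ex_bij_betw_finite_nat[OF finite_elements[OF fin part]] m by (auto simp: atLeast0LessThan)
  have ne: "pverts G \<noteq> {}"
    using n assms(1,3) by force
  \<comment> \<open>Colors are numbered from \<open>1\<close>, residues from \<open>0\<close>.\<close>
  define c where "c v = Suc (h (Q v) mod k)" for v
  have c: "c v \<in> {1..k}" for v
    using assms(2) by (simp add: c_def Suc_le_eq)
  have defect: "vertex_defect G k (pure_coloring c) v = (real m / real k - 1) * real a"
    if v: "v \<in> pverts G" for v
  proof -
    let ?C = "{P \<in> Ps. h P mod k = h (Q v) mod k}"
    have "bij_betw h ?C {i. i < m \<and> i mod k = h (Q v) mod k}"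
      using h by (auto simp: bij_betw_def inj_on_def)
    then have "card ?C = m div k"
      using card_residue_class_below[OF assms(4), of "h (Q v) mod k"] assms(2)
      by (simp add: bij_betw_same_card)
    moreover have "a * card ?C = card (\<Union>?C)"
    proof (rule card_partition)
      show "finite ?C"
        using finite_elements[OF fin part] by simp
      show "finite (\<Union>?C)"
        by (rule finite_subset[OF _ fin]) (use U in auto)
    qed (use a disj in auto)
    moreover have "\<Union>?C = {w \<in> pverts G. c w = c v}"
      using U Q Q_eq by (auto simp: c_def)
    ultimately have "card {w \<in> pverts G. c w = c v} = a * (m div k)"
      by simp
    moreover have "{w \<in> neighbors G v. c w = c v} = {w \<in> pverts G. c w = c v} - Q v"
      using nb v by (auto simp: Q_def)
    moreover have sub: "Q v \<subseteq> {w \<in> pverts G. c w = c v}"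
    proof
      fix w assume "w \<in> Q v"
      with Q[OF v] have "w \<in> pverts G" "Q w = Q v"
        using U Q_eq by blast+
      then show "w \<in> {w \<in> pverts G. c w = c v}"
        by (simp add: c_def)
    qed
    moreover have "card (Q v) = a"
      using a Q[OF v] by simp
    moreover have finQ: "finite (Q v)"
      using sub fin by (auto intro: finite_subset)
    ultimately have "card {w \<in> neighbors G v. c w = c v} = a * (m div k) - a"
      by (simp add: card_Diff_subset)
    moreover have "m div k \<ge> 1"
      using assms(1,2,4) by (simp add: Suc_le_eq div_greater_zero_iff dvd_imp_le)
    then have "a * (m div k) \<ge> a"
      by simp
    ultimately have "real (card {w \<in> neighbors G v. c w = c v}) = real a * (real m / real k) - real a"
      using assms(4) by (simp add: of_nat_diff real_of_nat_div)
    moreover have "finite (neighbors G v)"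
      using nb v fin by (auto intro: finite_subset)
    ultimately show ?thesis
      by (simp add: vertex_defect_pure_coloring[where c = c, OF c] algebra_simps)
  qed
  then have "vertex_defect G k (pure_coloring c) ` pverts G = {(real m / real k - 1) * real a}"
    using ne by (auto simp: image_iff)
  then have "coloring_defect G k (pure_coloring c) = (real m / real k - 1) * real a"
    by (simp add: coloring_defect_def)
  moreover have "frac_coloring G k (pure_coloring c)"
    by (rule frac_coloring_pure_coloring) (rule c)
  ultimately show ?thesis
    by blast
qed

theorem proposition5:
  fixes G :: "'a pair_pre_digraph" and m k a :: nat
  assumes "m \<ge> 1" and "k \<ge> 1" and "a \<ge> 1"
    and "k dvd m"
    and "complete_multipartite m a G"
  shows "(\<exists>f. frac_coloring G k f \<and> coloring_defect G k f = (real m / real k - 1) * real a) \<and>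
    (\<forall>f. frac_coloring G k f \<longrightarrow> coloring_defect G k f \<ge> (real m / real k - 1) * real a) \<and>
    min_defect G k = (real m / real k - 1) * real a"
proof -
  have upper: "\<exists>f. frac_coloring G k f \<and> coloring_defect G k f = (real m / real k - 1) * real a"
    using assms by (rule complete_multipartite_coloring_exists)
  have lower: "\<forall>f. frac_coloring G k f \<longrightarrow> coloring_defect G k f \<ge> (real m / real k - 1) * real a"
    using complete_multipartite_defect_lower_bound[OF assms(1-3,5)] by blast
  have "min_defect G k = (real m / real k - 1) * real a"
    unfolding min_defect_def
  proof (rule Least_equality)
    show "\<exists>f. frac_coloring G k f \<and> (real m / real k - 1) * real a = coloring_defect G k f"
      using upper by metis
  qed (use lower in blast)
  with upper lower show ?thesis
    by blast
qed

end
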